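(* For infinitely many $n$, there exists a self-complementary graph $G$ on $n$ vertices with $\mathrm{cp}(G) \geq \frac{23}{164}n^2 + o(n^2)$. That is, there exist an infinite set $S$ of positive integers and a function $\varepsilon : S \to \mathbb{R}$ with $\varepsilon(n) \to 0$ as $n \to \infty$ in $S$, such that for every $n \in S$ there is a graph $G$ on $n$ vertices with $G \cong \overline{G}$ and $\mathrm{cp}(G) \geq \frac{23}{164}n^2 + \varepsilon(n) n^2$.
   Context: Graphs are finite and simple; $\overline{G}$ denotes the complement of $G$, and $G$ is self-complementary if $G \cong \overline{G}$. A clique partition of $G$ is a collection of subgraphs of $G$, each isomorphic to a complete graph $K_r$ with $r \geq 2$, such that each edge of $G$ belongs to exactly one subgraph of the collection. The clique partition number $\mathrm{cp}(G)$ is the minimum size of a clique partition of $G$. *)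

theory Defs
  imports Complex_Main "Graph_Theory.Graph_Theory"
begin

text \<open>
  A finite simple graph is a \<^locale>\<open>pair_graph\<close>: a finite vertex set with a symmetric,
  irreflexive arc relation, each undirected edge \<open>uv\<close> being the pair of arcs \<open>(u, v)\<close>, \<open>(v, u)\<close>.
\<close>

definition graph_complement :: "'a pair_pre_digraph \<Rightarrow> 'a pair_pre_digraph" where
  "graph_complement G =
     \<lparr> pverts = pverts G,
       parcs = {(u, v). u \<in> pverts G \<and> v \<in> pverts G \<and> u \<noteq> v \<and> (u, v) \<notin> parcs G} \<rparr>"

definition self_complementary :: "'a pair_pre_digraph \<Rightarrow> bool" where
  "self_complementary G \<longleftrightarrow> digraph_iso (with_proj G) (with_proj (graph_complement G))"

text \<open>
  A set of subgraphs suffices as the collection: cliques on at least two vertices have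
  an edge, so none can occur twice. The members are symmetric, so the arcs \<open>(u, v)\<close>
  and \<open>(v, u)\<close> of an edge lie in the same member.
\<close>

definition clique_partition :: "'a pair_pre_digraph \<Rightarrow> 'a pair_pre_digraph set \<Rightarrow> bool" where
  "clique_partition G C \<longleftrightarrow>
     (\<forall>H\<in>C. subgraph (with_proj H) (with_proj G) \<and>
            (\<exists>r\<ge>2. complete_digraph r (with_proj H))) \<and>
     (\<forall>e\<in>parcs G. \<exists>!H. H \<in> C \<and> e \<in> parcs H)"

definition cp :: "'a pair_pre_digraph \<Rightarrow> nat" where
  "cp G = (LEAST k. \<exists>C. clique_partition G C \<and> finite C \<and> card C = k)"

lemma pair_graph_complement:
  assumes "pair_graph G"
  shows "pair_graph (graph_complement G)"
proof -
  interpret pair_graph G by fact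
  have "parcs (graph_complement G) \<subseteq> pverts G \<times> pverts G"
    by (auto simp: graph_complement_def)
  then have "finite (parcs (graph_complement G))"
    using pair_finite_verts by (meson finite_SigmaI finite_subset)
  moreover have "(v, u) \<in> parcs G \<longleftrightarrow> (u, v) \<in> parcs G" for u v
    using arcs_ends_symmetric[OF pair_sym_arcs] by auto
  ultimately show ?thesis
    using pair_finite_verts
    by unfold_locales (auto simp: graph_complement_def symmetric_def sym_def)
qed

text \<open>The least element in the definition of \<^const>\<open>cp\<close> exists: take every edge as a \<open>K\<^sub>2\<close>.\<close>

lemma clique_partition_exists:
  assumes "pair_graph G"
  shows "\<exists>C. clique_partition G C \<and> finite C"
proof -
  interpret pair_graph G by fact
  define K where "K = (\<lambda>(u, v). \<lparr> pverts = {u, v}, parcs = {(u, v), (v, u)} \<rparr> :: 'a pair_pre_digraph)"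
  have sym: "(v, u) \<in> parcs G" if "(u, v) \<in> parcs G" for u v
    using that arcs_ends_symmetric[OF pair_sym_arcs] by auto
  have "subgraph (with_proj (K e)) (with_proj G) \<and>
        (\<exists>r\<ge>2. complete_digraph r (with_proj (K e)))" if e: "e \<in> parcs G" for e
  proof -
    obtain u v where [simp]: "e = (u, v)" by (cases e)
    have uv: "u \<noteq> v" "u \<in> pverts G" "v \<in> pverts G" "(v, u) \<in> parcs G"
      using e pair_no_loops[OF e] sym in_arcsD1 in_arcsD2 by auto
    have "wf_digraph (with_proj (K e))"
      by unfold_locales (auto simp: K_def)
    then have "subgraph (with_proj (K e)) (with_proj G)"
      using uv e wf_digraph by (auto simp: subgraph_def compatible_def K_def)
    moreover have "complete_digraph 2 (with_proj (K e))"
      using uv unfolding complete_digraph_pair_def by (auto simp: K_def)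
    ultimately show ?thesis by blast
  qed
  moreover have "\<exists>!H. H \<in> K ` parcs G \<and> e \<in> parcs H" if e: "e \<in> parcs G" for e
  proof (rule ex1I[of _ "K e"])
    show "K e \<in> K ` parcs G \<and> e \<in> parcs (K e)"
      using e by (auto simp: K_def split: prod.splits)
  qed (auto simp: K_def)
  ultimately have "clique_partition G (K ` parcs G)"
    by (auto simp: clique_partition_def)
  then show ?thesis using pair_finite_arcs by blast
qed

end

theory Submission
  imports Defs
begin

text \<open>
  If the edges of a graph carry weights, possibly negative, such that no clique has total
  weight above 1, then every clique partition has at least as many members as the total
  weight of all edges. This is weak linear programming duality, and it reduces the theorem
  to finding a self-complementary graph with a good weighting.

  The graph is a blow-up of the five-cycle \<open>M - A\<^sub>0 - B\<^sub>1 - B\<^sub>3 - A\<^sub>2 - M\<close>. The parts \<open>A\<^sub>0\<close>, \<open>A\<^sub>2\<close>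
  are cliques of size \<open>p\<close>, the parts \<open>B\<^sub>1\<close>, \<open>B\<^sub>3\<close> are independent of size \<open>p\<close>, and \<open>M\<close>, of size
  \<open>c\<close>, is itself self-complementary. The rotation \<open>A\<^sub>0 \<rightarrow> B\<^sub>1 \<rightarrow> A\<^sub>2 \<rightarrow> B\<^sub>3 \<rightarrow> A\<^sub>0\<close> exchanges cliques with
  independent sets, and adjacent parts with non-adjacent ones; with an antimorphism of \<open>M\<close> it
  is an isomorphism onto the complement. The part \<open>M\<close> is taken to be the same path \<open>A\<^sub>0 - B\<^sub>1 - B\<^sub>3 - A\<^sub>2\<close>,
  blown up with parts of size \<open>q = c / 4\<close>, so that one rotation serves for everything.

  An edge between two parts has weight 1, an edge inside \<open>A\<^sub>0\<close> or \<open>A\<^sub>2\<close> has weight \<open>-1\<close>, and an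
  edge inside \<open>M\<close> has weight \<open>-2\<close>. Since the five-cycle has no triangle, a clique meets at most
  two parts, which must be adjacent. The critical cliques have \<open>s\<close> vertices in one part \<open>A\<^sub>i\<close> and \<open>t\<close> in
  \<open>M\<close>; their weight \<open>s t - s (s - 1) / 2 - t (t - 1)\<close> never exceeds 1
  (\<open>clique_join_bound\<close>). A clique with a single vertex in some \<open>B\<^sub>i\<close> and \<open>s\<close> vertices in an \<open>A\<^sub>j\<close>
  obeys the case \<open>t = 1\<close> of the same inequality.

  The graph \<open>M\<close> contains half of all pairs of its vertices, so up to linear terms the total weight is
  \<open>3 p\<^sup>2 - p\<^sup>2 + 2 p c - c\<^sup>2 / 2\<close>. Among all sizes with \<open>4 p + c = n\<close> this is largest for
  \<open>p = 3 n / 14\<close> and \<open>c = n / 7\<close>, where it equals \<open>n\<^sup>2 / 7\<close>. The linear terms are non-negative and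
  \<open>1 / 7 > 23 / 164\<close>, so the theorem holds with error term 0 along the multiples of 28.
\<close>

section \<open>Lower bounds from edge weights\<close>

text \<open>
  The arcs of the members of a clique partition decompose the arcs of the graph, so summing the
  clique bound over the members gives the claim. Everything is counted over arcs, where each
  edge occurs twice; hence the bound 2 for a clique of weight 1, and the factor 2 at the end.
\<close>

lemma cp_ge_half_weight:
  fixes w :: "'a \<Rightarrow> 'a \<Rightarrow> int"
  assumes G: "pair_graph G"
    and clique: "\<And>K. K \<subseteq> pverts G \<Longrightarrow>
      (\<And>u v. u \<in> K \<Longrightarrow> v \<in> K \<Longrightarrow> u \<noteq> v \<Longrightarrow> (u, v) \<in> parcs G) \<Longrightarrow>
      (\<Sum>u\<in>K. \<Sum>v\<in>K - {u}. w u v) \<le> 2"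
  shows "(\<Sum>(u, v)\<in>parcs G. w u v) \<le> 2 * int (cp G)"
proof -
  interpret pair_graph G by fact
  have "\<exists>C. clique_partition G C \<and> finite C \<and> card C = cp G"
    unfolding cp_def using clique_partition_exists[OF G] by (rule_tac LeastI_ex) blast
  then obtain C where C: "clique_partition G C" "finite C" "card C = cp G"
    by blast
  have sub: "pverts H \<subseteq> pverts G" "parcs H \<subseteq> parcs G" if "H \<in> C" for H
    using C(1) that unfolding clique_partition_def subgraph_def by auto
  have complete: "finite (pverts H)"
    "parcs H = {(u, v). (u, v) \<in> pverts H \<times> pverts H \<and> u \<noteq> v}" if "H \<in> C" for H
    using C(1) that unfolding clique_partition_def complete_digraph_pair_def by blast+
  have fin: "finite (parcs H)" if "H \<in> C" for H
    using sub(2)[OF that] pair_finite_arcs finite_subset by blast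
  have union: "parcs G = (\<Union>H\<in>C. parcs H)"
    using C(1) sub unfolding clique_partition_def by blast
  have disjoint: "parcs H \<inter> parcs H' = {}" if "H \<in> C" "H' \<in> C" "H \<noteq> H'" for H H'
  proof -
    have "\<exists>!H. H \<in> C \<and> e \<in> parcs H" if "e \<in> parcs G" for e
      using C(1) that unfolding clique_partition_def by blast
    then show ?thesis using that sub by blast
  qed
  have le2: "(\<Sum>(u, v)\<in>parcs H. w u v) \<le> 2" if H: "H \<in> C" for H
  proof -
    have "parcs H = Sigma (pverts H) (\<lambda>u. pverts H - {u})"
      by (subst complete(2)[OF H]) auto
    then have "(\<Sum>(u, v)\<in>parcs H. w u v) = (\<Sum>u\<in>pverts H. \<Sum>v\<in>pverts H - {u}. w u v)"
      using complete(1)[OF H] by (simp add: sum.Sigma)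
    also have "\<dots> \<le> 2"
    proof (rule clique)
      show "pverts H \<subseteq> pverts G" by (rule sub[OF H])
      show "(u, v) \<in> parcs G" if "u \<in> pverts H" "v \<in> pverts H" "u \<noteq> v" for u v
      proof -
        have "(u, v) \<in> parcs H" by (subst complete(2)[OF H]) (use that in simp)
        then show ?thesis using sub(2)[OF H] by blast
      qed
    qed
    finally show ?thesis .
  qed
  have "(\<Sum>(u, v)\<in>parcs G. w u v) = (\<Sum>H\<in>C. \<Sum>(u, v)\<in>parcs H. w u v)"
    unfolding union by (rule sum.UNION_disjoint) (use C(2) fin disjoint in auto)
  also have "\<dots> \<le> (\<Sum>H\<in>C. 2)"
    by (rule sum_mono) (rule le2)
  finally show ?thesis using C(3) by simp
qed

section \<open>A self-complementary graph of five-cycle type\<close>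

text \<open>
  Vertices are numbers, and the residue modulo 4 of a vertex is the index of its part. The outer
  vertices, those below \<open>4 * p\<close>, form \<open>A\<^sub>0\<close>, \<open>B\<^sub>1\<close>, \<open>A\<^sub>2\<close>, \<open>B\<^sub>3\<close>; the others form \<open>M\<close>.
  The relation below is the path \<open>0 - 1 - 3 - 2\<close> with a loop at 0 and 2, a loop standing for
  a part that is a clique.
\<close>

definition quarter_adj :: "nat \<Rightarrow> nat \<Rightarrow> bool" where
  "quarter_adj i k \<longleftrightarrow>
     (i, k) \<in> {(0, 0), (2, 2), (0, 1), (1, 0), (1, 3), (3, 1), (3, 2), (2, 3)}"

text \<open>
  The outer vertices and \<open>M\<close> both follow the path. Between them, \<open>M\<close> is joined to \<open>A\<^sub>0\<close> and
  \<open>A\<^sub>2\<close>, that is, to the even outer vertices; the minimum of a mixed pair is its outer vertex.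
  The relation may hold for a vertex and itself, so that it depends on the parts alone.
\<close>

definition class_adj :: "nat \<Rightarrow> nat \<Rightarrow> nat \<Rightarrow> bool" where
  "class_adj p u v \<longleftrightarrow>
     (if u < 4 * p \<longleftrightarrow> v < 4 * p then quarter_adj (u mod 4) (v mod 4) else even (min u v))"

definition C5_graph :: "nat \<Rightarrow> nat \<Rightarrow> nat pair_pre_digraph" where
  "C5_graph p q =
     \<lparr> pverts = {..<4 * p + 4 * q},
       parcs = {(u, v). u < 4 * p + 4 * q \<and> v < 4 * p + 4 * q \<and> u \<noteq> v \<and> class_adj p u v} \<rparr>"

lemma quarter_adj_commute: "quarter_adj i k \<longleftrightarrow> quarter_adj k i"
  by (auto simp: quarter_adj_def)

lemma class_adj_commute: "class_adj p u v \<longleftrightarrow> class_adj p v u"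
  by (auto simp: class_adj_def quarter_adj_commute min.commute)

lemma pair_graph_C5_graph: "pair_graph (C5_graph p q)"
proof -
  have "finite (parcs (C5_graph p q))"
    by (rule finite_subset[of _ "{..<4 * p + 4 * q} \<times> {..<4 * p + 4 * q}"])
      (auto simp: C5_graph_def)
  then show ?thesis
    by unfold_locales
      (auto simp: C5_graph_def symmetric_def sym_def class_adj_commute)
qed

text \<open>
  This antimorphism permutes each block \<open>{4 k, ..., 4 k + 3}\<close> cyclically, so it preserves both
  the outer vertices and \<open>M\<close>, and it interchanges even and odd vertices.
\<close>

definition rotate_parts :: "nat \<Rightarrow> nat" where
  "rotate_parts v = (if v mod 4 = 3 then v - 3 else v + 1)"

lemma rotate_parts_mod: "rotate_parts v mod 4 = Suc (v mod 4) mod 4"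
proof (cases "v mod 4 = 3")
  case True
  then have "v = 4 * (v div 4) + 3" using div_mult_mod_eq[of v 4] by simp
  then obtain k where "v = 4 * k + 3" by blast
  then show ?thesis by (simp add: rotate_parts_def)
next
  case False
  then show ?thesis by (simp add: rotate_parts_def mod_Suc_eq)
qed

lemma rotate_parts_div: "rotate_parts v div 4 = v div 4"
proof (cases "v mod 4 = 3")
  case True
  then have "v = 4 * (v div 4) + 3" using div_mult_mod_eq[of v 4] by simp
  then obtain k where "v = 4 * k + 3" by blast
  then show ?thesis by (simp add: rotate_parts_def)
next
  case False
  then show ?thesis by (simp add: rotate_parts_def div_Suc) presburger
qed

lemma rotate_parts_less_iff: "rotate_parts v < 4 * m \<longleftrightarrow> v < 4 * m"
proof -
  have "u < 4 * m \<longleftrightarrow> u div 4 < m" for u :: nat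
    by (simp add: div_less_iff_less_mult mult.commute)
  then show ?thesis by (simp add: rotate_parts_div)
qed

lemma even_rotate_parts: "even (rotate_parts v) \<longleftrightarrow> odd v"
 unfolding rotate_parts_def by presburger

lemma inj_rotate_parts: "inj rotate_parts"
proof (rule injI)
  fix u v assume "rotate_parts u = rotate_parts v"
  then have "u div 4 = v div 4" "Suc (u mod 4) mod 4 = Suc (v mod 4) mod 4"
    by (metis rotate_parts_div, metis rotate_parts_mod)
  then have "u div 4 = v div 4" "u mod 4 = v mod 4"
    by (auto simp: mod_Suc split: if_splits)
  then show "u = v" by (metis div_mult_mod_eq)
qed

lemma rotate_parts_image: "rotate_parts ` {..<4 * m} = {..<4 * m}"
proof (rule endo_inj_surj)
  show "rotate_parts ` {..<4 * m} \<subseteq> {..<4 * m}" by (auto simp: rotate_parts_less_iff)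
  show "inj_on rotate_parts {..<4 * m}" using inj_rotate_parts by (rule inj_on_subset) simp
qed simp

lemma quarter_adj_rotate_parts:
  assumes "i < 4" "k < 4"
  shows "quarter_adj (Suc i mod 4) (Suc k mod 4) \<longleftrightarrow> \<not> quarter_adj i k"
proof -
  have "i \<in> {0, 1, 2, 3}" "k \<in> {0, 1, 2, 3}" using assms by auto
  then show ?thesis by (elim insertE emptyE; simp add: quarter_adj_def)
qed

lemma class_adj_rotate_parts: "class_adj p (rotate_parts u) (rotate_parts v) \<longleftrightarrow> \<not> class_adj p u v"
proof (cases "u < 4 * p \<longleftrightarrow> v < 4 * p")
  case True
  then show ?thesis
    by (simp add: class_adj_def rotate_parts_less_iff rotate_parts_mod quarter_adj_rotate_parts)
next
  case False
  have "min (rotate_parts u) (rotate_parts v) = rotate_parts (min u v)"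
    using False rotate_parts_less_iff[of u p] rotate_parts_less_iff[of v p]
    by (cases "u < 4 * p") (auto simp: min_def)
  then show ?thesis using False
    by (simp add: class_adj_def rotate_parts_less_iff even_rotate_parts)
qed

text \<open>
  The rotation is injective, maps the vertex set onto itself and inverts adjacency. These facts
  place the image of the arc set inside the complement, and surjectivity on vertices gives the
  reverse inclusion.
\<close>

lemma self_complementary_C5_graph: "self_complementary (C5_graph p q)"
proof -
  let ?G = "C5_graph p q" and ?n = "4 * p + 4 * q"
  define f where "f = \<lparr> iso_verts = rotate_parts, iso_arcs = map_prod rotate_parts rotate_parts,
    iso_head = snd, iso_tail = fst \<rparr>"
  interpret pair_graph ?G by (rule pair_graph_C5_graph)
  have less: "rotate_parts v < ?n \<longleftrightarrow> v < ?n" for v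
    using rotate_parts_less_iff[of v "p + q"] by (simp add: algebra_simps)
  have image: "rotate_parts ` {..<?n} = {..<?n}"
    using rotate_parts_image[of "p + q"] by (simp add: algebra_simps)
  have "digraph_isomorphism f"
    unfolding digraph_isomorphism_def f_def
    using wf_digraph by (auto intro!: inj_onI simp: inj_eq[OF inj_rotate_parts])
  moreover have "map_prod rotate_parts rotate_parts ` parcs ?G = parcs (graph_complement ?G)"
      (is "?L = ?R")
  proof
    show "?L \<subseteq> ?R"
      by (auto simp: C5_graph_def graph_complement_def less class_adj_rotate_parts
          inj_eq[OF inj_rotate_parts])
    show "?R \<subseteq> ?L"
    proof
      fix e assume e: "e \<in> ?R"
      obtain u v where uv: "e = (rotate_parts u, rotate_parts v)" "u < ?n" "v < ?n"
      proof -
        have "fst e \<in> {..<?n}" "snd e \<in> {..<?n}"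
          using e by (auto simp: C5_graph_def graph_complement_def)
        then have "fst e \<in> rotate_parts ` {..<?n}" "snd e \<in> rotate_parts ` {..<?n}"
          by (simp_all only: image)
        then obtain u v where "fst e = rotate_parts u" "u < ?n" "snd e = rotate_parts v" "v < ?n"
          by (elim imageE) simp
        then show thesis using that[of u v] by (simp add: prod_eq_iff)
      qed
      then have "(u, v) \<in> parcs ?G"
        using e by (auto simp: C5_graph_def graph_complement_def less class_adj_rotate_parts)
      then show "e \<in> ?L" using uv(1) by force
    qed
  qed
  then have "with_proj (graph_complement ?G) = app_iso f (with_proj ?G)"
    using image by (simp add: app_iso_def f_def with_proj_def graph_complement_def C5_graph_def)
  ultimately show ?thesis
    unfolding self_complementary_def digraph_iso_def by blast
qed

section \<open>The clique partition number of the construction\<close>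

text \<open>
  Two outer vertices that are adjacent and both even lie in the same part, which is why
  \<open>-1\<close> is given to all even outer pairs. The values at non-adjacent pairs and at equal arguments
  have no meaning of their own; they are chosen so that the weight depends only on which of
  \<open>A = A\<^sub>0 \<union> A\<^sub>2\<close>, \<open>B = B\<^sub>1 \<union> B\<^sub>3\<close> and \<open>M\<close> contain the two vertices.
\<close>

definition C5_weight :: "nat \<Rightarrow> nat \<Rightarrow> nat \<Rightarrow> int" where
  "C5_weight p u v =
     (if u < 4 * p \<and> v < 4 * p then if even u \<and> even v then - 1 else 1
      else if u < 4 * p \<or> v < 4 * p then if even (min u v) then 1 else 0
      else - 2)"

lemma sum_quarters:
  fixes f :: "nat \<Rightarrow> int"
  assumes "\<And>i. i < 4 * m \<Longrightarrow> f i = h (i mod 4)"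
  shows "(\<Sum>i<4 * m. f i) = int m * (h 0 + h 1 + h 2 + h 3)"
  using assms
proof (induction m)
  case (Suc m)
  have "f (4 * m + j) = h j" if "j < 4" for j
    using Suc.prems[of "4 * m + j"] that by simp
  from this[of 0] this[of 1] this[of 2] this[of 3]
  have "f (4 * m) = h 0" "f (Suc (4 * m)) = h 1" "f (Suc (Suc (4 * m))) = h 2"
    "f (Suc (Suc (Suc (4 * m)))) = h 3"
    by (simp_all add: eval_nat_numeral)
  moreover have "(\<Sum>i<4 * m. f i) = int m * (h 0 + h 1 + h 2 + h 3)"
    by (rule Suc.IH) (rule Suc.prems, simp)
  moreover have "4 * Suc m = Suc (Suc (Suc (Suc (4 * m))))" by simp
  ultimately have "(\<Sum>i<4 * Suc m. f i) = int m * (h 0 + h 1 + h 2 + h 3) + h 0 + h 1 + h 2 + h 3"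
    by (simp only: sum.lessThan_Suc)
  then show ?case by (simp add: algebra_simps)
qed simp

lemma sum_lessThan_add:
  fixes f :: "nat \<Rightarrow> int"
  shows "(\<Sum>i<m + n. f i) = (\<Sum>i<m. f i) + (\<Sum>i<n. f (m + i))"
  by (induction n) (simp_all add: add.assoc)

lemma sum_two_quarters:
  fixes f :: "nat \<Rightarrow> int"
  assumes "\<And>i. i < 4 * p \<Longrightarrow> f i = h (i mod 4)"
    and "\<And>i. 4 * p \<le> i \<Longrightarrow> f i = h' (i mod 4)"
  shows "(\<Sum>i<4 * p + 4 * q. f i) =
    int p * (h 0 + h 1 + h 2 + h 3) + int q * (h' 0 + h' 1 + h' 2 + h' 3)"
proof -
  have "(\<Sum>i<4 * p + 4 * q. f i) = (\<Sum>i<4 * p. f i) + (\<Sum>i<4 * q. f (4 * p + i))"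
    by (rule sum_lessThan_add)
  also have "(\<Sum>i<4 * p. f i) = int p * (h 0 + h 1 + h 2 + h 3)"
    by (rule sum_quarters) (rule assms(1))
  also have "(\<Sum>i<4 * q. f (4 * p + i)) = int q * (h' 0 + h' 1 + h' 2 + h' 3)"
    by (rule sum_quarters) (simp add: assms(2))
  finally show ?thesis .
qed

lemma even_mod_4: "even (v mod 4) \<longleftrightarrow> even (v :: nat)"
  by presburger

text \<open>
  By symmetry the weighted degree of a vertex is determined by its part: it is \<open>4 q + 1\<close> on
  \<open>A\<close>, \<open>2 p\<close> on \<open>B\<close>, and \<open>2 p - 4 q\<close> on \<open>M\<close>, plus 2 on the parts of \<open>M\<close> that are cliques.
\<close>

lemma sum_C5_weight:
  "(\<Sum>(u, v)\<in>parcs (C5_graph p q). C5_weight p u v) =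
     4 * (int p)\<^sup>2 + 16 * int p * int q - 16 * (int q)\<^sup>2 + 2 * int p + 4 * int q"
proof -
  let ?n = "4 * p + 4 * q"
  \<comment> \<open>The sums below run over all pairs of vertices, where a function of the parts is easy to
    sum; the diagonal terms, present in the clique parts, are then subtracted.\<close>
  define g where "g u v = (if class_adj p u v then C5_weight p u v else 0)" for u v
  have mod4: "i mod 4 \<in> {0, 1, 2, 3}" for i :: nat by auto
  have parity: "even i \<longleftrightarrow> i mod 4 = 0 \<or> i mod 4 = 2" for i :: nat by presburger
  define h where "h i = (if i = 0 \<or> i = 2 then 4 * int q + 1 else 2 * int p)" for i :: nat
  define h' where "h' i = 2 * int p - 4 * int q + (if i = 0 \<or> i = 2 then 2 else 0)" for i :: nat
  have inner: "(\<Sum>v<?n. g u v) - g u u = h (u mod 4)" if "u < 4 * p" for u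
  proof -
    have "(\<Sum>v<?n. g u v) =
      (let s = (\<lambda>k. if quarter_adj (u mod 4) k
          then if even u \<and> even k then - 1 else 1 else 0);
         t = (\<lambda>k. if even u then 1 else 0)
       in int p * (s 0 + s 1 + s 2 + s 3) + int q * (t 0 + t 1 + t 2 + t (3::nat)))"
      unfolding Let_def
      by (rule sum_two_quarters)
        (use that in \<open>auto simp: g_def class_adj_def C5_weight_def min_def even_mod_4\<close>)
    moreover have "g u u = (if even u then - 1 else 0)"
      using mod4[of u] that
      by (auto simp: g_def class_adj_def C5_weight_def quarter_adj_def parity)
    ultimately show ?thesis
      using mod4[of u] by (auto simp: h_def quarter_adj_def Let_def parity)
  qed
  have outer: "(\<Sum>v<?n. g u v) - g u u = h' (u mod 4)" if "4 * p \<le> u" for u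
  proof -
    have "(\<Sum>v<?n. g u v) =
      (let s = (\<lambda>k. if even (k :: nat) then 1 else 0);
         t = (\<lambda>k. if quarter_adj (u mod 4) k then - 2 else 0)
       in int p * (s 0 + s 1 + s 2 + s 3) + int q * (t 0 + t 1 + t 2 + t (3::nat)))"
      unfolding Let_def
      by (rule sum_two_quarters)
        (use that in \<open>auto simp: g_def class_adj_def C5_weight_def min_def even_mod_4\<close>)
    moreover have "g u u = (if even u then - 2 else 0)"
      using mod4[of u] that
      by (auto simp: g_def class_adj_def C5_weight_def quarter_adj_def parity)
    ultimately show ?thesis
      using mod4[of u] by (auto simp: h'_def quarter_adj_def Let_def parity)
  qed
  have arcs: "parcs (C5_graph p q) =
      Sigma {..<?n} (\<lambda>u. {v \<in> {..<?n} - {u}. class_adj p u v})"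
    by (auto simp: C5_graph_def)
  have "(\<Sum>(u, v)\<in>parcs (C5_graph p q). C5_weight p u v) =
      (\<Sum>u<?n. \<Sum>v\<in>{v \<in> {..<?n} - {u}. class_adj p u v}. C5_weight p u v)"
    unfolding arcs by (simp add: sum.Sigma)
  also have "\<dots> = (\<Sum>u<?n. (\<Sum>v<?n. g u v) - g u u)"
  proof (rule sum.cong[OF refl])
    fix u assume "u \<in> {..<?n}"
    have "(\<Sum>v\<in>{v \<in> {..<?n} - {u}. class_adj p u v}. C5_weight p u v) =
        (\<Sum>v\<in>{..<?n} - {u}. g u v)"
      unfolding g_def by (rule sum.inter_filter) simp
    also have "\<dots> = (\<Sum>v<?n. g u v) - g u u"
      using \<open>u \<in> {..<?n}\<close> by (simp add: sum_diff1)
    finally show "(\<Sum>v\<in>{v \<in> {..<?n} - {u}. class_adj p u v}. C5_weight p u v) =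
        (\<Sum>v<?n. g u v) - g u u" .
  qed
  also have "\<dots> = int p * (h 0 + h 1 + h 2 + h 3) + int q * (h' 0 + h' 1 + h' 2 + h' 3)"
    by (rule sum_two_quarters) (use inner outer in auto)
  also have "\<dots> = 4 * (int p)\<^sup>2 + 16 * int p * int q - 16 * (int q)\<^sup>2 + 2 * int p + 4 * int q"
    by (simp add: h_def h'_def power2_eq_square algebra_simps)
  finally show ?thesis .
qed

text \<open>
  Four times the difference of the two sides is
  \<open>(2 * s - 2 * t - 1)\<^sup>2 + (2 * t - 3)\<^sup>2 - 2\<close>. It is non-negative because both squares are
  squares of odd integers; over the reals the inequality fails, for example at
  \<open>s = 2\<close> and \<open>t = 3 / 2\<close>.
\<close>

lemma clique_join_bound:
  fixes s t :: int
  shows "2 * s * t - s * (s - 1) - 2 * t * (t - 1) \<le> 2"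
proof -
  have odd_square: "1 \<le> x * x" if "odd x" for x :: int
  proof -
    have "x \<noteq> 0" using that by auto
    then have "0 < x * x" by (auto simp: zero_less_mult_iff neq_iff)
    then show ?thesis by simp
  qed
  have "1 \<le> (2 * s - 2 * t - 1) * (2 * s - 2 * t - 1)" "1 \<le> (2 * t - 3) * (2 * t - 3)"
    by (rule odd_square, simp)+
  then show ?thesis by (simp add: algebra_simps)
qed

text \<open>
  Let the clique have \<open>s\<close>, \<open>b\<close> and \<open>t\<close> vertices in \<open>A\<close>, \<open>B\<close> and \<open>M\<close>. Its weight is a
  quadratic form in these numbers. Since \<open>B\<close> and \<open>M\<close> are not joined, \<open>b > 0\<close> forces \<open>t = 0\<close>; since
  \<open>B\<^sub>1\<close> and \<open>B\<^sub>3\<close> are independent and have no common neighbour, \<open>b \<le> 2\<close>, and \<open>b = 2\<close> forces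
  \<open>s = 0\<close>. Each remaining case is an instance of the previous inequality or an edge.
\<close>

lemma C5_weight_clique:
  assumes K: "K \<subseteq> pverts (C5_graph p q)"
    and clique: "\<And>u v. u \<in> K \<Longrightarrow> v \<in> K \<Longrightarrow> u \<noteq> v \<Longrightarrow> (u, v) \<in> parcs (C5_graph p q)"
  shows "(\<Sum>u\<in>K. \<Sum>v\<in>K - {u}. C5_weight p u v) \<le> 2"
proof -
  define A where "A = {v \<in> K. v < 4 * p \<and> even v}"
  define B where "B = {v \<in> K. v < 4 * p \<and> odd v}"
  define M where "M = {v \<in> K. 4 * p \<le> v}"
  define s b t where "s = int (card A)" and "b = int (card B)" and "t = int (card M)"
  have "finite K" using K finite_subset by (auto simp: C5_graph_def)
  then have fin: "finite A" "finite B" "finite M" by (auto simp: A_def B_def M_def)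
  have split: "K = A \<union> B \<union> M" "A \<inter> B = {}" "(A \<union> B) \<inter> M = {}"
    by (auto simp: A_def B_def M_def)
  have adj: "class_adj p u v" if "u \<in> K" "v \<in> K" "u \<noteq> v" for u v
    using clique[OF that] by (simp add: C5_graph_def)
  have sum_split: "(\<Sum>v\<in>K. f v) = (\<Sum>v\<in>A. f v) + (\<Sum>v\<in>B. f v) + (\<Sum>v\<in>M. f v)" for f :: "nat \<Rightarrow> int"
    unfolding split(1) using fin split(2,3) by (simp add: sum.union_disjoint)
  have remove: "(\<Sum>v\<in>K - {u}. f v) = (\<Sum>v\<in>K. f v) - f u" if "u \<in> K" for f :: "nat \<Rightarrow> int" and u
    using \<open>finite K\<close> that by (simp add: sum_diff1)
  have A: "(\<Sum>v\<in>K - {u}. C5_weight p u v) = b + t - (s - 1)" if "u \<in> A" for u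
  proof -
    have "(\<Sum>v\<in>A. C5_weight p u v) = (\<Sum>v\<in>A. - 1)" "(\<Sum>v\<in>B. C5_weight p u v) = (\<Sum>v\<in>B. 1)"
      "(\<Sum>v\<in>M. C5_weight p u v) = (\<Sum>v\<in>M. 1)" "C5_weight p u u = - 1" "u \<in> K"
      using that by (auto simp: A_def B_def M_def C5_weight_def min_def intro!: sum.cong)
    then show ?thesis by (simp add: remove sum_split s_def b_def t_def)
  qed
  have B: "(\<Sum>v\<in>K - {u}. C5_weight p u v) = s + (b - 1)" if "u \<in> B" for u
  proof -
    have "(\<Sum>v\<in>A. C5_weight p u v) = (\<Sum>v\<in>A. 1)" "(\<Sum>v\<in>B. C5_weight p u v) = (\<Sum>v\<in>B. 1)"
      "(\<Sum>v\<in>M. C5_weight p u v) = (\<Sum>v\<in>M. 0)" "C5_weight p u u = 1" "u \<in> K"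
      using that by (auto simp: A_def B_def M_def C5_weight_def min_def intro!: sum.cong)
    then show ?thesis by (simp add: remove sum_split s_def b_def t_def)
  qed
  have M: "(\<Sum>v\<in>K - {u}. C5_weight p u v) = s - 2 * (t - 1)" if "u \<in> M" for u
  proof -
    have "(\<Sum>v\<in>A. C5_weight p u v) = (\<Sum>v\<in>A. 1)" "(\<Sum>v\<in>B. C5_weight p u v) = (\<Sum>v\<in>B. 0)"
      "(\<Sum>v\<in>M. C5_weight p u v) = (\<Sum>v\<in>M. - 2)" "C5_weight p u u = - 2" "u \<in> K"
      using that by (auto simp: A_def B_def M_def C5_weight_def min_def intro!: sum.cong)
    then show ?thesis by (simp add: remove sum_split s_def b_def t_def)
  qed
  have total: "(\<Sum>u\<in>K. \<Sum>v\<in>K - {u}. C5_weight p u v) =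
      s * (b + t - (s - 1)) + b * (s + (b - 1)) + t * (s - 2 * (t - 1))"
    unfolding sum_split using A B M by (simp add: s_def b_def t_def)
  show ?thesis
  proof (cases "B = {}")
    case True
    then have "b = 0" by (simp add: b_def)
    then show ?thesis using clique_join_bound[of s t] total by (simp add: algebra_simps)
  next
    case False
    then obtain x where x: "x \<in> B" by blast
    have "M = {}"
    proof (rule ccontr)
      assume "M \<noteq> {}"
      then obtain y where "y \<in> M" by blast
      then show False using x adj[of x y] by (auto simp: B_def M_def class_adj_def min_def)
    qed
    then have t: "t = 0" by (simp add: t_def)
    have odd_adj: "u mod 4 \<noteq> v mod 4" if "u \<in> B" "v \<in> B" "u \<noteq> v" for u v
    proof
      assume "u mod 4 = v mod 4"
      then have "quarter_adj (u mod 4) (u mod 4)" "odd (u mod 4)"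
        using adj[of u v] that by (auto simp: B_def class_adj_def even_mod_4)
      then show False by (auto simp: quarter_adj_def)
    qed
    show ?thesis
    proof (cases "B = {x}")
      case True
      then have "b = 1" by (simp add: b_def)
      \<comment> \<open>A single vertex of \<open>B\<close> contributes exactly as a single vertex of \<open>M\<close> would.\<close>
      then show ?thesis using clique_join_bound[of s 1] total t by (simp add: algebra_simps)
    next
      case False
      then obtain y where y: "y \<in> B" "y \<noteq> x" using x by blast
      have mod4: "v mod 4 = 1 \<or> v mod 4 = 3" if "v \<in> B" for v
      proof -
        have "odd v" using that by (simp add: B_def)
        then show ?thesis by presburger
      qed
      have "v = x \<or> v = y" if "v \<in> B" for v
        using odd_adj[OF that x] odd_adj[OF that y(1)] odd_adj[OF x y(1)] y(2)
          mod4[OF that] mod4[OF x] mod4[OF y(1)]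
        by (cases "v = x"; cases "v = y") auto
      then have "B = {x, y}" using x y by blast
      then have b: "b = 2" using y by (simp add: b_def)
      have "A = {}"
      proof (rule ccontr)
        assume "A \<noteq> {}"
        then obtain a where a: "a \<in> A" by blast
        have "quarter_adj (a mod 4) (x mod 4)" "quarter_adj (a mod 4) (y mod 4)"
          using a x y adj[of a x] adj[of a y] by (auto simp: A_def B_def class_adj_def)
        moreover have "even (a mod 4)" using a by (auto simp: A_def even_mod_4)
        ultimately show False
          using odd_adj[OF x y(1)] y(2) mod4[OF x] mod4[OF y(1)]
          by (auto simp: quarter_adj_def)
      qed
      then show ?thesis using total t b by (simp add: s_def)
    qed
  qed
qed

lemma cp_C5_graph_ge:
  "2 * (int p)\<^sup>2 + 8 * int p * int q - 8 * (int q)\<^sup>2 \<le> int (cp (C5_graph p q))"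
proof -
  have "(\<Sum>(u, v)\<in>parcs (C5_graph p q). C5_weight p u v) \<le> 2 * int (cp (C5_graph p q))"
    by (rule cp_ge_half_weight[OF pair_graph_C5_graph], rule C5_weight_clique; blast)
  then show ?thesis unfolding sum_C5_weight by linarith
qed

theorem theorem1p4:
  shows "\<exists>(S :: nat set) (\<epsilon> :: nat \<Rightarrow> real).
           infinite S \<and> (\<forall>n\<in>S. n > 0) \<and>
           (\<epsilon> \<longlongrightarrow> 0) (inf at_top (principal S)) \<and>
           (\<forall>n\<in>S. \<exists>G :: nat pair_pre_digraph.
              pair_graph G \<and> card (pverts G) = n \<and> self_complementary G \<and>
              real (cp G) \<ge> 23 / 164 * (real n)\<^sup>2 + \<epsilon> n * (real n)\<^sup>2)"
proof -
  define S where "S = range (\<lambda>k. 28 * Suc k)"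
  have "infinite S"
    unfolding S_def by (rule range_inj_infinite) (simp add: inj_def)
  moreover have "\<exists>G :: nat pair_pre_digraph.
      pair_graph G \<and> card (pverts G) = n \<and> self_complementary G \<and>
      real (cp G) \<ge> 23 / 164 * (real n)\<^sup>2" if "n \<in> S" for n
  proof (intro exI conjI)
    obtain k where n: "n = 28 * k" using \<open>n \<in> S\<close> unfolding S_def by blast
    \<comment> \<open>The optimal ratio: outer parts of size \<open>6 k = 3 n / 14\<close>, and \<open>M\<close> of size \<open>4 k = n / 7\<close>.\<close>
    let ?G = "C5_graph (6 * (n div 28)) (n div 28)"
    show "pair_graph ?G" by (rule pair_graph_C5_graph)
    show "card (pverts ?G) = n" by (simp add: C5_graph_def n)
    show "self_complementary ?G" by (rule self_complementary_C5_graph)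
    have "112 * (int k)\<^sup>2 \<le> int (cp ?G)"
      using cp_C5_graph_ge[of "6 * k" k] by (simp add: n power2_eq_square)
    then have "real_of_int (112 * (int k)\<^sup>2) \<le> real_of_int (int (cp ?G))"
      by (simp only: of_int_le_iff)
    then have "(real n)\<^sup>2 / 7 \<le> real (cp ?G)"
      by (simp add: n power_mult_distrib)
    moreover have "23 / 164 * (real n)\<^sup>2 \<le> (real n)\<^sup>2 / 7"
      by simp
    ultimately show "23 / 164 * (real n)\<^sup>2 \<le> real (cp ?G)" by linarith
  qed
  ultimately show ?thesis
    by (intro exI[of _ S] exI[of _ "\<lambda>_. 0"]) (auto simp: S_def)
qed

end
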